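(* For every cubic graph $G$, $\nu_2(G)+\nu_3(G)\geq 2|V(G)|$.
   Context: All graphs are finite and undirected, without loops; multiple edges are allowed. A cubic graph is a $3$-regular graph. For a graph $G$ and a positive integer $k$, $\nu_k(G)$ denotes the maximum of $|H_1|+\dots+|H_k|$ over all $k$-tuples $(H_1,\dots,H_k)$ of pairwise edge-disjoint matchings of $G$, i.e. the maximum number of edges of a $k$-edge-colorable subgraph of $G$. *)

theory Defs
  imports Main "HOL-Library.Disjoint_Sets"
begin

(* Edges are objects of their own, so several edges may have the same pair of ends. *)
record ('v, 'e) multigraph =
  verts :: "'v set"
  edges :: "'e set"
  ends :: "'e \<Rightarrow> 'v set"

(* The condition on the cardinality excludes loops. *)
locale finite_multigraph =
  fixes G :: "('v, 'e) multigraph"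
  assumes finite_verts: "finite (verts G)"
    and finite_edges: "finite (edges G)"
    and ends_subset: "e \<in> edges G \<Longrightarrow> ends G e \<subseteq> verts G"
    and card_ends: "e \<in> edges G \<Longrightarrow> card (ends G e) = 2"

definition degree :: "('v, 'e) multigraph \<Rightarrow> 'v \<Rightarrow> nat" where
  "degree G v = card {e \<in> edges G. v \<in> ends G e}"

locale cubic_multigraph = finite_multigraph +
  assumes cubic: "v \<in> verts G \<Longrightarrow> degree G v = 3"

definition matching :: "('v, 'e) multigraph \<Rightarrow> 'e set \<Rightarrow> bool" where
  "matching G M \<longleftrightarrow> M \<subseteq> edges G \<and> disjoint_family_on (ends G) M"

(* A k-tuple is given by the values of H at 0, ..., k - 1; its other values are irrelevant. *)
definition disjoint_matchings :: "('v, 'e) multigraph \<Rightarrow> nat \<Rightarrow> (nat \<Rightarrow> 'e set) \<Rightarrow> bool" where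
  "disjoint_matchings G k H \<longleftrightarrow> (\<forall>i<k. matching G (H i)) \<and> disjoint_family_on H {..<k}"

definition nu :: "nat \<Rightarrow> ('v, 'e) multigraph \<Rightarrow> nat" where
  "nu k G = Max {\<Sum>i<k. card (H i) | H. disjoint_matchings G k H}"

(* The maximum in nu is over a finite nonempty set, hence attained. *)
lemma (in finite_multigraph) nu_set_finite_nonempty:
  shows "finite {\<Sum>i<k. card (H i) | H. disjoint_matchings G k H}"
    and "{\<Sum>i<k. card (H i) | H. disjoint_matchings G k H} \<noteq> {}"
proof -
  have "(\<Sum>i<k. card (H i)) \<le> k * card (edges G)" if "disjoint_matchings G k H" for H
  proof -
    have "card (H i) \<le> card (edges G)" if "i < k" for i
      using \<open>disjoint_matchings G k H\<close> that finite_edges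
      by (auto simp: disjoint_matchings_def matching_def intro: card_mono)
    then show ?thesis
      using sum_bounded_above[of "{..<k}" "\<lambda>i. card (H i)" "card (edges G)"] by simp
  qed
  then have "{\<Sum>i<k. card (H i) | H. disjoint_matchings G k H} \<subseteq> {..k * card (edges G)}"
    by auto
  then show "finite {\<Sum>i<k. card (H i) | H. disjoint_matchings G k H}"
    by (rule finite_subset) simp
  have "disjoint_matchings G k (\<lambda>_. {})"
    by (simp add: disjoint_matchings_def matching_def disjoint_family_on_def)
  then show "{\<Sum>i<k. card (H i) | H. disjoint_matchings G k H} \<noteq> {}"
    by blast
qed

end

theory Submission
  imports Defs "HOL-Combinatorics.Transposition"
begin

text \<open>
  It suffices to find disjoint matchings
  \<open>M\<^sub>0, M\<^sub>1, M\<^sub>2\<close> with \<open>4|M\<^sub>0| + 3(|M\<^sub>1| + |M\<^sub>2|) \<ge> 4|V|\<close>: the larger of \<open>M\<^sub>1, M\<^sub>2\<close> together with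
  \<open>M\<^sub>0\<close> then bounds \<open>\<nu>\<^sub>2\<close>. We take \<open>M\<^sub>0\<close> a maximum matching and then \<open>|M\<^sub>1| + |M\<^sub>2|\<close> maximal. Kempe
  exchanges show that every vertex misses at most one colour, so the uncoloured edges form a
  matching. Let \<open>k\<close> be the number of vertices missing colour 0, and \<open>m\<close> the number of uncoloured
  edges between a vertex missing 1 and a vertex missing 2; the inequality becomes
  \<open>2|V| \<ge> 7k + 6m\<close>. Each of the \<open>m\<close> edges lies on an odd cycle of the colours 1, 2, three
  vertices of which are set aside (the predicate \<open>core\<close>). The set \<open>U\<close> of the \<open>k\<close> vertices
  missing colour 0 sends \<open>3k\<close> edges to its neighbourhood \<open>W\<close>, and a vertex of \<open>W\<close> receives at
  most two of them. Vertices receiving two have their \<open>M\<^sub>0\<close>-partners outside \<open>U \<union> W\<close>, since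
  otherwise \<open>M\<^sub>0\<close> could be augmented, and at most \<open>k/2\<close> of these partners are core vertices,
  since otherwise an exchange moves a missing colour 0 into the core. Hence there are at least
  \<open>7k/2\<close> vertices in \<open>U\<close>, in \<open>W\<close> and among these partners that are not core vertices.
\<close>

section \<open>Vertex sets closed under a set of edges\<close>

context finite_multigraph
begin

lemma ends_obtain:
  assumes "e \<in> edges G" "x \<in> ends G e"
  obtains y where "ends G e = {x, y}" "y \<noteq> x" "x \<in> verts G" "y \<in> verts G"
proof -
  obtain a b where ab: "ends G e = {a, b}" "a \<noteq> b"
    using card_ends[OF assms(1)] by (auto simp: card_2_iff)
  have "a \<in> verts G" "b \<in> verts G" using ends_subset[OF assms(1)] ab by auto
  then show ?thesis using ab assms(2) that[of a] that[of b] by (auto simp: insert_commute)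
qed

text \<open>The component of \<open>x\<close> is grown one vertex and one edge at a time.\<close>
lemma exists_closed_tree_like:
  assumes "H \<subseteq> edges G" "x \<in> verts G"
  obtains T where "T \<subseteq> verts G" "x \<in> T"
    "\<And>e. e \<in> H \<Longrightarrow> ends G e \<inter> T \<noteq> {} \<Longrightarrow> ends G e \<subseteq> T"
    "card T \<le> 1 + card {e \<in> H. ends G e \<subseteq> T}"
proof -
  let ?P = "\<lambda>T. T \<subseteq> verts G \<and> x \<in> T \<and> card T \<le> 1 + card {e \<in> H. ends G e \<subseteq> T}"
  have finH: "finite H" using assms(1) finite_edges finite_subset by blast
  have start: "?P {x}" using assms(2) by simp
  have bound: "\<forall>T. ?P T \<longrightarrow> card T < Suc (card (verts G))"
    using finite_verts by (auto simp: less_Suc_eq_le intro: card_mono)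
  from ex_has_greatest_nat[of ?P "{x}" card, OF start bound]
  obtain T where T: "?P T" and max: "\<forall>T'. ?P T' \<longrightarrow> card T' \<le> card T" by (elim exE conjE) blast
  have finT: "finite T" using T finite_verts finite_subset by blast
  have "ends G e \<subseteq> T" if e: "e \<in> H" "ends G e \<inter> T \<noteq> {}" for e
  proof (rule ccontr)
    assume no: "\<not> ends G e \<subseteq> T"
    obtain a where a: "a \<in> ends G e" "a \<in> T" using e by blast
    obtain y where y: "ends G e = {a, y}" "y \<in> verts G"
      using ends_obtain[of e a] e assms(1) a by blast
    have yT: "y \<notin> T" using no y a by auto
    have "insert e {e \<in> H. ends G e \<subseteq> T} \<subseteq> {e \<in> H. ends G e \<subseteq> insert y T}"
      using e y a by auto
    then have "card (insert e {e \<in> H. ends G e \<subseteq> T}) \<le> card {e \<in> H. ends G e \<subseteq> insert y T}"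
      using finH by (intro card_mono) auto
    then have "?P (insert y T)" using T yT finT y no finH e by auto
    then have "card (insert y T) \<le> card T" by (rule max[rule_format])
    then show False using yT finT by simp
  qed
  then show ?thesis using T that by blast
qed

section \<open>Partial 3-edge-colourings and their optimality\<close>

text \<open>Colour 3 means uncoloured.\<close>
definition colouring :: "('e \<Rightarrow> nat) \<Rightarrow> bool" where
  "colouring c \<longleftrightarrow> (\<forall>e\<in>edges G. c e \<le> 3) \<and>
     (\<forall>e\<in>edges G. \<forall>f\<in>edges G. e \<noteq> f \<longrightarrow> c e = c f \<longrightarrow> c e < 3 \<longrightarrow> ends G e \<inter> ends G f = {})"

definition colour_class :: "('e \<Rightarrow> nat) \<Rightarrow> nat \<Rightarrow> 'e set" where
  "colour_class c i = {e \<in> edges G. c e = i}"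

definition coloured :: "('e \<Rightarrow> nat) \<Rightarrow> 'e set" where
  "coloured c = {e \<in> edges G. c e < 3}"

definition misses :: "('e \<Rightarrow> nat) \<Rightarrow> nat \<Rightarrow> 'v \<Rightarrow> bool" where
  "misses c i x \<longleftrightarrow> (\<forall>e\<in>edges G. x \<in> ends G e \<longrightarrow> c e \<noteq> i)"

text \<open>Lexicographic: colour 0 is first made a maximum matching, and only then is the number of
  coloured edges maximised. Every recolouring below therefore has to keep track of the size of class
  0.\<close>

definition optimal :: "('e \<Rightarrow> nat) \<Rightarrow> bool" where
  "optimal c \<longleftrightarrow> colouring c \<and> (\<forall>c'. colouring c' \<longrightarrow>
     card (colour_class c' 0) \<le> card (colour_class c 0) \<and>
     (card (colour_class c' 0) = card (colour_class c 0) \<longrightarrow> card (coloured c') \<le> card (coloured c)))"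

lemma finite_colour_class [simp]: "finite (colour_class c i)"
  and finite_coloured [simp]: "finite (coloured c)"
  using finite_edges by (auto simp: colour_class_def coloured_def)

lemma same_colour_eq:
  "colouring c \<Longrightarrow> e \<in> edges G \<Longrightarrow> f \<in> edges G \<Longrightarrow> c e = c f \<Longrightarrow> c e < 3 \<Longrightarrow>
   x \<in> ends G e \<Longrightarrow> x \<in> ends G f \<Longrightarrow> e = f"
  unfolding colouring_def by blast

lemma colour_le: "colouring c \<Longrightarrow> e \<in> edges G \<Longrightarrow> c e \<le> 3"
  unfolding colouring_def by blast

lemma colouring_uncolour: "colouring c \<Longrightarrow> colouring (c(e := 3))"
  unfolding colouring_def by auto

lemma colouring_upd:
  assumes "colouring c" "i < 3" "\<forall>x\<in>ends G e. misses c i x"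
  shows "colouring (c(e := i))"
  using assms unfolding colouring_def misses_def by auto

lemma misses_uncolour:
  assumes "colouring c" "e \<in> edges G" "c e < 3" "x \<in> ends G e"
  shows "misses (c(e := 3)) (c e) x"
  unfolding misses_def
proof (intro ballI impI)
  fix f assume "f \<in> edges G" "x \<in> ends G f"
  then show "(c(e := 3)) f \<noteq> c e"
    using same_colour_eq[OF assms(1,2), of f x] assms by (cases "f = e") auto
qed

lemma misses_upd: "misses c i x \<Longrightarrow> x \<notin> ends G e \<or> j \<noteq> i \<Longrightarrow> misses (c(e := j)) i x"
  by (auto simp: misses_def)

lemma card_colour_class_upd:
  assumes "e \<in> edges G"
  shows "card (colour_class (c(e := j)) i) + (if c e = i then 1 else 0) =
    card (colour_class c i) + (if j = i then 1 else 0)"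
proof -
  define R where "R = colour_class c i - {e}"
  have 1: "colour_class c i = (if c e = i then insert e R else R)"
    using assms by (auto simp: R_def colour_class_def)
  have 2: "colour_class (c(e := j)) i = (if j = i then insert e R else R)"
    using assms by (auto simp: R_def colour_class_def)
  have fin: "finite R" "e \<notin> R" by (auto simp: R_def)
  have "card (colour_class c i) = card R + (if c e = i then 1 else 0)"
    by (subst 1) (use fin in auto)
  moreover have "card (colour_class (c(e := j)) i) = card R + (if j = i then 1 else 0)"
    by (subst 2) (use fin in auto)
  ultimately show ?thesis by simp
qed

lemma card_coloured_upd:
  assumes "e \<in> edges G"
  shows "card (coloured (c(e := j))) + (if c e < 3 then 1 else 0) =
    card (coloured c) + (if j < 3 then 1 else 0)"
proof -
  define R where "R = coloured c - {e}"
  have 1: "coloured c = (if c e < 3 then insert e R else R)"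
    using assms by (auto simp: R_def coloured_def)
  have 2: "coloured (c(e := j)) = (if j < 3 then insert e R else R)"
    using assms by (auto simp: R_def coloured_def)
  have fin: "finite R" "e \<notin> R" by (auto simp: R_def)
  have "card (coloured c) = card R + (if c e < 3 then 1 else 0)"
    by (subst 1) (use fin in auto)
  moreover have "card (coloured (c(e := j))) = card R + (if j < 3 then 1 else 0)"
    by (subst 2) (use fin in auto)
  ultimately show ?thesis by simp
qed

lemma optimal_colouring: "optimal c \<Longrightarrow> colouring c"
  by (simp add: optimal_def)

text \<open>Class 0 of \<open>c\<close> already has maximum size, so the hypothesis forces the two
  sizes to agree and the second criterion applies.\<close>

lemma optimal_not_better:
  assumes "optimal c" "colouring c'" "card (colour_class c 0) \<le> card (colour_class c' 0)"
  shows "card (coloured c') \<le> card (coloured c)"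
  using assms unfolding optimal_def by (metis le_antisym)

lemma optimalI:
  assumes "optimal c" "colouring c'" "card (colour_class c' 0) = card (colour_class c 0)"
    "card (coloured c') = card (coloured c)"
  shows "optimal c'"
  using assms unfolding optimal_def by metis

text \<open>The edges of colour \<open>i\<close> inside \<open>T\<close> are disjoint pairs, and as
  \<open>T\<close> is closed they cover exactly the vertices of \<open>T\<close> that do not miss
  \<open>i\<close>.\<close>

lemma card_closed_colour_class:
  assumes c: "colouring c" and i: "i < 3" and T: "T \<subseteq> verts G"
    and closed: "\<And>e. e \<in> edges G \<Longrightarrow> c e = i \<Longrightarrow> ends G e \<inter> T \<noteq> {} \<Longrightarrow> ends G e \<subseteq> T"
  shows "2 * card {e \<in> colour_class c i. ends G e \<subseteq> T} + card {x \<in> T. misses c i x} = card T"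
proof -
  let ?F = "{e \<in> colour_class c i. ends G e \<subseteq> T}"
  have finT: "finite T" using T finite_verts finite_subset by blast
  have "card (\<Union>e\<in>?F. ends G e) = (\<Sum>e\<in>?F. card (ends G e))"
  proof (rule card_UN_disjoint)
    show "finite ?F" by simp
    show "\<forall>e\<in>?F. finite (ends G e)" using finT finite_subset by blast
    show "\<forall>e\<in>?F. \<forall>f\<in>?F. e \<noteq> f \<longrightarrow> ends G e \<inter> ends G f = {}"
      using c i unfolding colouring_def colour_class_def by auto
  qed
  also have "\<dots> = 2 * card ?F" using card_ends by (simp add: colour_class_def)
  also have "(\<Union>e\<in>?F. ends G e) = {x \<in> T. \<not> misses c i x}"
    using closed unfolding misses_def colour_class_def by blast
  finally have "2 * card ?F = card {x \<in> T. \<not> misses c i x}" by simp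
  moreover have "card {x \<in> T. \<not> misses c i x} + card {x \<in> T. misses c i x} = card T"
    using finT by (subst card_Un_disjoint[symmetric]) (auto intro: arg_cong[where f = card])
  ultimately show ?thesis by simp
qed

section \<open>Kempe exchanges\<close>

text \<open>A Kempe chain through \<open>x\<close> without paths: \<open>T\<close> has at most one
  vertex more than it has edges of the two colours, while twice its size is twice that number of
  edges plus the two counts of missing vertices. So these counts sum to at most 2, as for the ends
  of a path.\<close>

lemma Kempe_set:
  assumes c: "colouring c" and ij: "i < 3" "j < 3" "i \<noteq> j" and x: "x \<in> verts G"
  obtains T where "T \<subseteq> verts G" "x \<in> T"
    "\<And>e. e \<in> edges G \<Longrightarrow> c e = i \<or> c e = j \<Longrightarrow> ends G e \<inter> T \<noteq> {} \<Longrightarrow> ends G e \<subseteq> T"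
    "card {y \<in> T. misses c i y} + card {y \<in> T. misses c j y} \<le> 2"
proof -
  obtain T where T: "T \<subseteq> verts G" "x \<in> T"
    "\<And>e. e \<in> colour_class c i \<union> colour_class c j \<Longrightarrow> ends G e \<inter> T \<noteq> {} \<Longrightarrow> ends G e \<subseteq> T"
    "card T \<le> 1 + card {e \<in> colour_class c i \<union> colour_class c j. ends G e \<subseteq> T}"
    using exists_closed_tree_like[of "colour_class c i \<union> colour_class c j" x] x
    by (auto simp: colour_class_def)
  have cl: "ends G e \<subseteq> T" if "e \<in> edges G" "c e = i \<or> c e = j" "ends G e \<inter> T \<noteq> {}" for e
    using T(3)[of e] that by (auto simp: colour_class_def)
  have "{e \<in> colour_class c i \<union> colour_class c j. ends G e \<subseteq> T} =
     {e \<in> colour_class c i. ends G e \<subseteq> T} \<union> {e \<in> colour_class c j. ends G e \<subseteq> T}" by auto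
  then have "card {e \<in> colour_class c i \<union> colour_class c j. ends G e \<subseteq> T} \<le>
     card {e \<in> colour_class c i. ends G e \<subseteq> T} + card {e \<in> colour_class c j. ends G e \<subseteq> T}"
    by (simp add: card_Un_le)
  moreover have "2 * card {e \<in> colour_class c i. ends G e \<subseteq> T} + card {x \<in> T. misses c i x} = card T"
    using card_closed_colour_class[OF c ij(1) T(1)] cl by blast
  moreover have "2 * card {e \<in> colour_class c j. ends G e \<subseteq> T} + card {x \<in> T. misses c j x} = card T"
    using card_closed_colour_class[OF c ij(2) T(1)] cl by blast
  ultimately have "card {y \<in> T. misses c i y} + card {y \<in> T. misses c j y} \<le> 2"
    using T(4) by linarith
  then show ?thesis using that T(1,2) cl by blast
qed

definition Kempe_swap :: "'v set \<Rightarrow> nat \<Rightarrow> nat \<Rightarrow> ('e \<Rightarrow> nat) \<Rightarrow> 'e \<Rightarrow> nat" where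
  "Kempe_swap T i j c e = (if ends G e \<subseteq> T then transpose i j (c e) else c e)"

text \<open>Two meeting edges with colours among \<open>i\<close> and \<open>j\<close> are both
  swapped or both left alone, because \<open>T\<close> is closed; equal new colours thus come from
  equal old ones.\<close>

lemma colouring_Kempe_swap:
  assumes c: "colouring c" and ij: "i < 3" "j < 3"
    and cl: "\<And>e. e \<in> edges G \<Longrightarrow> c e = i \<or> c e = j \<Longrightarrow> ends G e \<inter> T \<noteq> {} \<Longrightarrow> ends G e \<subseteq> T"
  shows "colouring (Kempe_swap T i j c)"
  unfolding colouring_def
proof (intro conjI ballI impI)
  fix e assume e: "e \<in> edges G"
  then show "Kempe_swap T i j c e \<le> 3"
    using c ij unfolding colouring_def Kempe_swap_def transpose_def by auto
  fix f assume f: "f \<in> edges G" and ne: "e \<noteq> f" and eq: "Kempe_swap T i j c e = Kempe_swap T i j c f"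
    and lt: "Kempe_swap T i j c e < 3"
  show "ends G e \<inter> ends G f = {}"
  proof (rule ccontr)
    assume meet: "ends G e \<inter> ends G f \<noteq> {}"
    have "c e = c f"
      using eq meet cl[OF e] cl[OF f] unfolding Kempe_swap_def transpose_def
      by (auto split: if_splits)
    moreover have "c e < 3"
      using lt ij unfolding Kempe_swap_def transpose_def by (auto split: if_splits)
    ultimately show False using c e f ne meet unfolding colouring_def by blast
  qed
qed

lemma coloured_Kempe_swap:
  assumes "i < 3" "j < 3"
  shows "coloured (Kempe_swap T i j c) = coloured c"
  using assms unfolding coloured_def Kempe_swap_def transpose_def by auto

lemma card_colour_class_Kempe_swap:
  assumes "i \<noteq> j"
  shows "card (colour_class (Kempe_swap T i j c) i) + card {e \<in> colour_class c i. ends G e \<subseteq> T} =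
    card (colour_class c i) + card {e \<in> colour_class c j. ends G e \<subseteq> T}"
proof -
  have "colour_class (Kempe_swap T i j c) i =
    {e \<in> colour_class c i. \<not> ends G e \<subseteq> T} \<union> {e \<in> colour_class c j. ends G e \<subseteq> T}"
    using assms unfolding colour_class_def Kempe_swap_def transpose_def by auto
  then have 1: "card (colour_class (Kempe_swap T i j c) i) =
    card {e \<in> colour_class c i. \<not> ends G e \<subseteq> T} + card {e \<in> colour_class c j. ends G e \<subseteq> T}"
    by (simp add: card_Un_disjoint disjoint_iff)
  have "colour_class c i = {e \<in> colour_class c i. \<not> ends G e \<subseteq> T} \<union> {e \<in> colour_class c i. ends G e \<subseteq> T}"
    by auto
  then have "card (colour_class c i) =
     card {e \<in> colour_class c i. \<not> ends G e \<subseteq> T} + card {e \<in> colour_class c i. ends G e \<subseteq> T}"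
    by (subst card_Un_disjoint[symmetric]) (auto intro: arg_cong[where f = card])
  with 1 show ?thesis by simp
qed

lemma Kempe_swap_commute: "Kempe_swap T i j c = Kempe_swap T j i c"
  by (auto simp: Kempe_swap_def transpose_commute fun_eq_iff)

text \<open>Otherwise \<open>e\<close> could be coloured \<open>i\<close> with no other edge
  changed.\<close>

lemma optimal_no_common_miss:
  assumes c: "optimal c" and e: "e \<in> edges G" "c e = 3" "ends G e = {x, y}" and i: "i < 3"
    and m: "misses c i x" "misses c i y"
  shows False
proof -
  have "colouring (c(e := i))"
    using colouring_upd[OF optimal_colouring[OF c] i, of e] m e by auto
  moreover have "card (colour_class c 0) \<le> card (colour_class (c(e := i)) 0)"
    using card_colour_class_upd[OF e(1), of c i 0] e by simp
  ultimately have "card (coloured (c(e := i))) \<le> card (coloured c)"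
    using optimal_not_better[OF c] by blast
  then show False using card_coloured_upd[OF e(1), of c i] e i by simp
qed

text \<open>If \<open>y\<close> were outside \<open>T\<close>, exchanging \<open>i\<close> and
  \<open>j\<close> on \<open>T\<close> would make both ends of \<open>e\<close> miss
  \<open>j\<close>, and \<open>e\<close> could be coloured in addition.\<close>

lemma Kempe_set_contains_end:
  assumes c: "optimal c" and e: "e \<in> edges G" "c e = 3" "ends G e = {x, y}"
    and ij: "i < 3" "j < 3" "i \<noteq> j"
    and m: "misses c i x" "misses c j y"
    and T: "T \<subseteq> verts G" "x \<in> T"
    "\<And>e. e \<in> edges G \<Longrightarrow> c e = i \<or> c e = j \<Longrightarrow> ends G e \<inter> T \<noteq> {} \<Longrightarrow> ends G e \<subseteq> T"
    "card {y \<in> T. misses c i y} + card {y \<in> T. misses c j y} \<le> 2"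
  shows "y \<in> T"
proof (rule ccontr)
  assume y: "y \<notin> T"
  have col: "colouring c" using c by (rule optimal_colouring)
  let ?c = "Kempe_swap T i j c"
  have col': "colouring ?c" by (rule colouring_Kempe_swap) (use col ij T in blast)+
  have finT: "finite T" using T finite_verts finite_subset by blast
  have eT: "?c e = 3" using e y by (simp add: Kempe_swap_def)
  have "misses ?c j x"
    unfolding misses_def
  proof (intro ballI impI)
    fix f assume f: "f \<in> edges G" "x \<in> ends G f"
    have "c f \<noteq> i" using m f by (auto simp: misses_def)
    then show "?c f \<noteq> j" using f T(2) T(3)[OF f(1)] ij
      by (auto simp: Kempe_swap_def transpose_def)
  qed
  moreover have "misses ?c j y"
    using y m ij unfolding misses_def Kempe_swap_def by auto
  ultimately have col'': "colouring (?c(e := j))" (is "colouring ?d")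
    using colouring_upd[OF col' ij(2), of e] e by auto
  have mi: "2 * card {e \<in> colour_class c i. ends G e \<subseteq> T} + card {x \<in> T. misses c i x} = card T"
    using card_closed_colour_class[OF col ij(1) T(1)] T(3) by blast
  have mj: "2 * card {e \<in> colour_class c j. ends G e \<subseteq> T} + card {x \<in> T. misses c j x} = card T"
    using card_closed_colour_class[OF col ij(2) T(1)] T(3) by blast
  \<comment> \<open>As \<open>x\<close> misses \<open>i\<close>, at least as many vertices of
    \<open>T\<close> miss \<open>i\<close> as miss \<open>j\<close>; hence the exchange costs
    \<open>i\<close> no edge and \<open>j\<close> at most one.\<close>
  have "card {y \<in> T. misses c i y} \<noteq> 0" using T(2) m finT by auto
  then have le: "card {e \<in> colour_class c i. ends G e \<subseteq> T} \<le> card {e \<in> colour_class c j. ends G e \<subseteq> T}"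
      "card {e \<in> colour_class c j. ends G e \<subseteq> T} \<le> card {e \<in> colour_class c i. ends G e \<subseteq> T} + 1"
    using mi mj T(4) by linarith+
  have d0: "card (colour_class ?d 0) = card (colour_class ?c 0) + (if j = 0 then 1 else 0)"
    using card_colour_class_upd[OF e(1), of ?c j 0] eT by simp
  \<comment> \<open>If \<open>j = 0\<close>, colouring \<open>e\<close> with 0 makes up for the one
    edge that class 0 may lose.\<close>
  have "card (colour_class c 0) \<le> card (colour_class ?d 0)"
  proof -
    consider "i = 0" | "j = 0" | "i \<noteq> 0" "j \<noteq> 0" by blast
    then show ?thesis
    proof cases
      case 1
      then show ?thesis using card_colour_class_Kempe_swap[OF ij(3), of T c] le d0 by simp
    next
      case 2
      then show ?thesis
        using card_colour_class_Kempe_swap[of j i T c] ij le d0 by (simp add: Kempe_swap_commute)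
    next
      case 3
      then have "colour_class ?c 0 = colour_class c 0"
        by (auto simp: colour_class_def Kempe_swap_def transpose_def)
      then show ?thesis using d0 by simp
    qed
  qed
  then have "card (coloured ?d) \<le> card (coloured c)"
    using optimal_not_better[OF c col''] by blast
  then show False
    using card_coloured_upd[OF e(1), of ?c j] eT ij coloured_Kempe_swap[OF ij(1,2), of T c] by simp
qed

text \<open>\<open>x\<close> and \<open>y\<close> already account for one vertex in each of the two
  counts, whose sum is at most 2.\<close>

lemma Kempe_set_deficient:
  assumes T: "card {y \<in> T. misses c i y} + card {y \<in> T. misses c j y} \<le> 2" "finite T"
    and xy: "x \<in> T" "y \<in> T" "misses c i x" "misses c j y"
    and z: "z \<in> T" "z \<noteq> x" "z \<noteq> y"
  shows "\<not> misses c i z" "\<not> misses c j z"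
proof -
  have *: "card {y \<in> T. misses c i y} \<ge> 1" "card {y \<in> T. misses c j y} \<ge> 1"
    using xy T(2) by (auto simp: Suc_le_eq card_gt_0_iff)
  show "\<not> misses c i z"
  proof
    assume "misses c i z"
    then have "card {x, z} \<le> card {y \<in> T. misses c i y}"
      using xy z T(2) by (intro card_mono) auto
    then show False using * z T(1) by simp
  qed
  show "\<not> misses c j z"
  proof
    assume "misses c j z"
    then have "card {y, z} \<le> card {y \<in> T. misses c j y}"
      using xy z T(2) by (intro card_mono) auto
    then show False using * z T(1) by simp
  qed
qed

end

section \<open>Missed colours and uncoloured edges in a cubic graph\<close>

context cubic_multigraph
begin

lemma card_incident: "x \<in> verts G \<Longrightarrow> card {e \<in> edges G. x \<in> ends G e} = 3"
  using cubic unfolding degree_def by simp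

text \<open>The degree equals the number of colours, and the coloured edges at \<open>x\<close>
  correspond bijectively to the colours present there.\<close>

lemma card_uncoloured_eq_card_missed:
  assumes c: "colouring c" and x: "x \<in> verts G"
  shows "card {e \<in> edges G. x \<in> ends G e \<and> c e = 3} = card {i. i < 3 \<and> misses c i x}"
proof -
  let ?C = "{e \<in> edges G. x \<in> ends G e \<and> c e < 3}"
  let ?N = "{e \<in> edges G. x \<in> ends G e \<and> c e = 3}"
  let ?M = "{i. i < 3 \<and> misses c i x}"
  let ?P = "{i. i < 3 \<and> \<not> misses c i x}"
  have "{e \<in> edges G. x \<in> ends G e} = ?C \<union> ?N"
    using colour_le[OF c] by (auto simp: le_less)
  then have 1: "card ?C + card ?N = 3"
    using card_incident[OF x] finite_edges by (simp add: card_Un_disjoint disjoint_iff)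
  have "inj_on c ?C" using same_colour_eq[OF c] by (auto simp: inj_on_def)
  moreover have "c ` ?C = ?P" by (auto simp: misses_def)
  ultimately have 2: "card ?C = card ?P" using card_image by fastforce
  have "?P \<union> ?M = {..<3}" by auto
  then have "card ?P + card ?M = 3"
    by (subst card_Un_disjoint[symmetric]) auto
  with 1 2 show ?thesis by simp
qed

lemma uncoloured_end_misses:
  assumes "colouring c" "e \<in> edges G" "c e = 3" "x \<in> ends G e"
  obtains i where "i < 3" "misses c i x"
proof -
  have x: "x \<in> verts G" using assms ends_subset by blast
  have "card {e \<in> edges G. x \<in> ends G e \<and> c e = 3} \<noteq> 0"
    using assms finite_edges by auto
  then have "{i. i < 3 \<and> misses c i x} \<noteq> {}"
    using card_uncoloured_eq_card_missed[OF assms(1) x] by auto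
  then show ?thesis using that by blast
qed

text \<open>Two missed colours mean two uncoloured edges at \<open>x\<close>. Their other ends can
  miss only the third colour \<open>k\<close>, so the Kempe set of \<open>x\<close> for
  \<open>i\<close> and \<open>k\<close> would contain three vertices missing one of these
  colours.\<close>

lemma optimal_misses_unique:
  assumes c: "optimal c" and x: "x \<in> verts G"
    and ij: "i < 3" "j < 3" "misses c i x" "misses c j x"
  shows "i = j"
proof (rule ccontr)
  assume ne: "i \<noteq> j"
  have col: "colouring c" using c by (rule optimal_colouring)
  let ?M = "{i. i < 3 \<and> misses c i x}"
  let ?N = "{e \<in> edges G. x \<in> ends G e \<and> c e = 3}"
  have "card {i, j} \<le> card ?M" using ij by (intro card_mono) auto
  then have "2 \<le> card ?N" using card_uncoloured_eq_card_missed[OF col x] ne by simp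
  then obtain S where S: "S \<subseteq> ?N" "card S = 2" by (meson obtain_subset_with_card_n)
  then obtain e f where ef: "e \<noteq> f" "e \<in> ?N" "f \<in> ?N"
    unfolding card_2_iff by blast
  obtain y where y: "ends G e = {x, y}" "y \<noteq> x" "y \<in> verts G" using ends_obtain[of e x] ef by auto
  obtain z where z: "ends G f = {x, z}" "z \<noteq> x" "z \<in> verts G" using ends_obtain[of f x] ef by auto
  obtain k where k: "k < 3" "misses c k y"
    using uncoloured_end_misses[OF col, of e y] ef y by auto
  obtain l where l: "l < 3" "misses c l z"
    using uncoloured_end_misses[OF col, of f z] ef z by auto
  have no: "\<not> (misses c m x \<and> misses c m y)" "\<not> (misses c m x \<and> misses c m z)" if "m < 3" for m
    using optimal_no_common_miss[OF c, of e x y m] optimal_no_common_miss[OF c, of f x z m] ef y z that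
    by auto
  have ki: "k \<noteq> i" "k \<noteq> j" "l \<noteq> i" "l \<noteq> j" using no k l ij by blast+
  then have kl: "l = k" using k l ij ne by linarith
  \<comment> \<open>For \<open>y = z\<close>, two uncoloured edges at \<open>y\<close> would mean
    two missed colours there, but only \<open>k\<close> is available.\<close>
  have "y \<noteq> z"
  proof
    assume yz: "y = z"
    have "card {e, f} \<le> card {e \<in> edges G. y \<in> ends G e \<and> c e = 3}"
      using ef y z yz finite_edges by (intro card_mono) auto
    then have "2 \<le> card {m. m < 3 \<and> misses c m y}"
      using card_uncoloured_eq_card_missed[OF col y(3)] ef by simp
    moreover have "{m. m < 3 \<and> misses c m y} \<subseteq> {k}"
    proof
      fix m assume "m \<in> {m. m < 3 \<and> misses c m y}"
      then have "m < 3" "misses c m y" by auto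
      then have "m \<noteq> i" "m \<noteq> j" using no ij by blast+
      then show "m \<in> {k}" using \<open>m < 3\<close> ki k ij ne by auto
    qed
    then have "card {m. m < 3 \<and> misses c m y} \<le> card {k}" by (intro card_mono) auto
    ultimately show False by simp
  qed
  obtain T where T: "T \<subseteq> verts G" "x \<in> T"
    "\<And>e. e \<in> edges G \<Longrightarrow> c e = i \<or> c e = k \<Longrightarrow> ends G e \<inter> T \<noteq> {} \<Longrightarrow> ends G e \<subseteq> T"
    "card {y \<in> T. misses c i y} + card {y \<in> T. misses c k y} \<le> 2"
    using Kempe_set[OF col ij(1) k(1) ki(1)[symmetric] x] by blast
  have "y \<in> T"
    by (rule Kempe_set_contains_end[OF c, of e x y i k T]) (use ef y ij k ki T in auto)
  moreover have "z \<in> T"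
    by (rule Kempe_set_contains_end[OF c, of f x z i k T]) (use ef z ij k l kl ki T in auto)
  moreover have "finite T" using T finite_verts finite_subset by blast
  ultimately show False
    using Kempe_set_deficient(2)[of T c i k x y z] T ij k l kl z y \<open>y \<noteq> z\<close> by auto
qed

lemma optimal_uncoloured_unique:
  assumes c: "optimal c" and e: "e \<in> edges G" "c e = 3" "x \<in> ends G e"
    and f: "f \<in> edges G" "c f = 3" "x \<in> ends G f"
  shows "e = f"
proof (rule ccontr)
  assume ne: "e \<noteq> f"
  have col: "colouring c" using c by (rule optimal_colouring)
  have x: "x \<in> verts G" using e ends_subset by blast
  obtain i where i: "i < 3" "misses c i x" using uncoloured_end_misses[OF col e] .
  have "card {e, f} \<le> card {e \<in> edges G. x \<in> ends G e \<and> c e = 3}"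
    using e f finite_edges by (intro card_mono) auto
  also have "\<dots> = card {j. j < 3 \<and> misses c j x}"
    by (rule card_uncoloured_eq_card_missed[OF col x])
  also have "{j. j < 3 \<and> misses c j x} = {i}"
    using optimal_misses_unique[OF c x] i by auto
  finally show False using ne by simp
qed

lemma missing_has_uncoloured:
  assumes c: "colouring c" and x: "x \<in> verts G" and i: "i < 3" "misses c i x"
  obtains e y where "e \<in> edges G" "c e = 3" "ends G e = {x, y}" "y \<noteq> x" "y \<in> verts G"
proof -
  have "card {i. i < 3 \<and> misses c i x} \<noteq> 0" using i by auto
  then have "{e \<in> edges G. x \<in> ends G e \<and> c e = 3} \<noteq> {}"
    using card_uncoloured_eq_card_missed[OF c x] by (metis card.empty)
  then obtain e where e: "e \<in> edges G" "x \<in> ends G e" "c e = 3" by blast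
  then show ?thesis using ends_obtain[of e x] that[of e] by metis
qed

section \<open>Moving an uncoloured edge; core vertices\<close>

text \<open>
  An uncoloured edge whose ends miss 1 and 2 can be moved along its odd cycle of colours 1 and 2.
  As no vertex misses two colours, the vertices it reaches do not miss colour 0.
\<close>
lemma rotate_optimal:
  assumes c: "optimal c" and e: "e \<in> edges G" "c e = 3" "ends G e = {v, w}"
    and j: "j \<in> {1, 2}" "misses c j w"
    and g: "g \<in> edges G" "c g = j" "v \<in> ends G g"
  shows "optimal (c(g := 3, e := j))"
proof -
  have col: "colouring c" using c by (rule optimal_colouring)
  have ne: "e \<noteq> g" using e g j by auto
  have "misses (c(g := 3)) j w" using j by (auto simp: misses_def)
  moreover have "misses (c(g := 3)) j v"
    using misses_uncolour[OF col g(1) _ g(3)] g j by auto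
  ultimately have col': "colouring (c(g := 3, e := j))"
    using colouring_upd[OF colouring_uncolour[OF col, of g], of j e] e j by auto
  show ?thesis
  proof (rule optimalI[OF c col'])
    show "card (colour_class (c(g := 3, e := j)) 0) = card (colour_class c 0)"
      using card_colour_class_upd[OF g(1), of c 3 0]
        card_colour_class_upd[OF e(1), of "c(g := 3)" j 0] e g j ne by auto
    show "card (coloured (c(g := 3, e := j))) = card (coloured c)"
      using card_coloured_upd[OF g(1), of c 3]
        card_coloured_upd[OF e(1), of "c(g := 3)" j] e g j ne by auto
  qed
qed

text \<open>Once \<open>g\<close> has lost its colour, \<open>z\<close> misses \<open>j\<close> and
  so cannot also miss 0.\<close>

lemma rotate_once:
  assumes c: "optimal c" and e: "e \<in> edges G" "c e = 3" "ends G e = {v, w}"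
    and j: "j \<in> {1, 2}" "misses c j w"
    and g: "g \<in> edges G" "c g = j" "ends G g = {v, z}" "z \<noteq> v"
  shows "\<not> misses c 0 z"
proof
  assume z0: "misses c 0 z"
  have col: "colouring c" using c by (rule optimal_colouring)
  have c': "optimal (c(g := 3, e := j))"
    by (rule rotate_optimal[OF c e j g(1,2)]) (use g in auto)
  have "z \<noteq> w" using j g by (auto simp: misses_def)
  then have ze: "z \<notin> ends G e" using e g by auto
  have zV: "z \<in> verts G" using g ends_subset by blast
  have "misses (c(g := 3, e := j)) j z"
    using misses_uncolour[OF col g(1), of z] g j ze by (auto intro!: misses_upd[of "c(g := 3)"])
  moreover have "misses (c(g := 3, e := j)) 0 z"
    using z0 ze by (auto simp: misses_def)
  ultimately have "j = 0"
    using optimal_misses_unique[OF c' zV, of j 0] j by auto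
  then show False using j by auto
qed

text \<open>After one rotation \<open>g\<close> is the uncoloured edge and \<open>v\<close> still
  misses \<open>i\<close>, so \<open>rotate_once\<close> applies again at \<open>z\<close> with
  \<open>h\<close>.\<close>

lemma rotate_twice:
  assumes c: "optimal c" and e: "e \<in> edges G" "c e = 3" "ends G e = {v, w}"
    and ij: "i \<in> {1, 2}" "j \<in> {1, 2}" "i \<noteq> j" "misses c i v" "misses c j w"
    and g: "g \<in> edges G" "c g = j" "ends G g = {v, z}"
    and h: "h \<in> edges G" "c h = i" "ends G h = {z, t}" "t \<noteq> z"
  shows "\<not> misses c 0 t"
proof
  assume t0: "misses c 0 t"
  have ne: "e \<noteq> g" using e g ij by auto
  have c': "optimal (c(g := 3, e := j))"
    by (rule rotate_optimal[OF c e ij(2,5) g(1,2)]) (use g in auto)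
  have "\<not> misses (c(g := 3, e := j)) 0 t"
  proof (rule rotate_once[OF c' g(1), of z v i h])
    show "misses (c(g := 3, e := j)) i v" using ij by (auto simp: misses_def)
    show "(c(g := 3, e := j)) h = i" using ij h g e by auto
  qed (use ij g h ne in \<open>auto simp: insert_commute\<close>)
  moreover have "misses (c(g := 3, e := j)) 0 t" using t0 ij by (auto simp: misses_def)
  ultimately show False by blast
qed

text \<open>\<open>z\<close> lies in the Kempe set of \<open>v\<close>, in which \<open>v\<close>
  and \<open>w\<close> are already the two vertices missing a colour.\<close>

lemma Kempe_neighbour_full:
  assumes c: "optimal c" and e: "e \<in> edges G" "c e = 3" "ends G e = {v, w}"
    and ij: "i < 3" "j < 3" "i \<noteq> j" "misses c i v" "misses c j w"
    and g: "g \<in> edges G" "c g = j" "ends G g = {v, z}" "z \<noteq> v"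
  shows "\<not> misses c i z"
proof -
  have col: "colouring c" using c by (rule optimal_colouring)
  have v: "v \<in> verts G" using e ends_subset by blast
  obtain T where T: "T \<subseteq> verts G" "v \<in> T"
    "\<And>e. e \<in> edges G \<Longrightarrow> c e = i \<or> c e = j \<Longrightarrow> ends G e \<inter> T \<noteq> {} \<Longrightarrow> ends G e \<subseteq> T"
    "card {y \<in> T. misses c i y} + card {y \<in> T. misses c j y} \<le> 2"
    using Kempe_set[OF col ij(1-3) v] by blast
  have "w \<in> T" by (rule Kempe_set_contains_end[OF c e ij T])
  moreover have "z \<in> T" using T(2) T(3)[OF g(1)] g by auto
  moreover have "z \<noteq> w" using ij g by (auto simp: misses_def)
  moreover have "finite T" using T finite_verts finite_subset by blast
  ultimately show ?thesis using Kempe_set_deficient(1)[OF T(4)] T(2) ij g by blast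
qed

text \<open>For optimal \<open>c\<close>, the vertices \<open>w\<close>, \<open>v\<close> and the
  neighbour of \<open>v\<close> along colour 2 are consecutive on the odd cycle formed by
  \<open>e\<close> and the chain of colours 1 and 2. They are distinct because \<open>w\<close>
  misses 2; a triangle provides no more than these three.\<close>

definition core where
  "core c y \<longleftrightarrow> (\<exists>e v w. e \<in> edges G \<and> c e = 3 \<and> ends G e = {v, w} \<and> v \<noteq> w \<and> misses c 1 v \<and> misses c 2 w \<and>
     (y = v \<or> y = w \<or> (\<exists>g\<in>edges G. c g = 2 \<and> ends G g = {v, y} \<and> y \<noteq> v)))"

lemma core_not_misses_0:
  assumes c: "optimal c" and y: "core c y"
  shows "\<not> misses c 0 y"
proof -
  obtain e v w where e: "e \<in> edges G" "c e = 3" "ends G e = {v, w}" "misses c 1 v" "misses c 2 w"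
    and yy: "y = v \<or> y = w \<or> (\<exists>g\<in>edges G. c g = 2 \<and> ends G g = {v, y} \<and> y \<noteq> v)"
    using y unfolding core_def by blast
  have V: "v \<in> verts G" "w \<in> verts G" using e ends_subset by blast+
  from yy show ?thesis
  proof (elim disjE bexE)
    assume "y = v"
    then show ?thesis using optimal_misses_unique[OF c V(1), of 0 1] e by auto
  next
    assume "y = w"
    then show ?thesis using optimal_misses_unique[OF c V(2), of 0 2] e by auto
  next
    fix g assume "g \<in> edges G" "c g = 2 \<and> ends G g = {v, y} \<and> y \<noteq> v"
    then show ?thesis using rotate_once[OF c e(1-3), of 2 g y] e by auto
  qed
qed

text \<open>By the colour of \<open>f\<close>, which is not 0: either rotating the uncoloured edge
  would reach \<open>u\<close>, or \<open>f\<close> is one of the edges defining the core, whose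
  ends do not miss 0, or \<open>f\<close> conflicts with the colours missed at
  \<open>y\<close>.\<close>

lemma core_not_adjacent:
  assumes c: "optimal c" and y: "core c y" and f: "f \<in> edges G" "ends G f = {u, y}"
    and u: "misses c 0 u"
  shows False
proof -
  have col: "colouring c" using c by (rule optimal_colouring)
  obtain e v w where e: "e \<in> edges G" "c e = 3" "ends G e = {v, w}" "v \<noteq> w" "misses c 1 v" "misses c 2 w"
    and yy: "y = v \<or> y = w \<or> (\<exists>g\<in>edges G. c g = 2 \<and> ends G g = {v, y} \<and> y \<noteq> v)"
    using y unfolding core_def by blast
  have cv: "core c v" "core c w" using e unfolding core_def by blast+
  have uvw: "u \<noteq> v" "u \<noteq> w" "u \<noteq> y" using core_not_misses_0[OF c] cv y u by blast+
  have e': "ends G e = {w, v}" using e by auto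
  have "c f \<noteq> 0" "c f \<le> 3" using u f col by (auto simp: misses_def colour_le)
  then consider (1) "c f = 1" | (2) "c f = 2" | (3) "c f = 3" by linarith
  note cf = this
  from yy show ?thesis
  proof (elim disjE bexE conjE)
    assume yv: "y = v"
    from cf show ?thesis
    proof cases
      case 1
      then show ?thesis using e f yv by (auto simp: misses_def)
    next
      case 2
      then show ?thesis using rotate_once[OF c e(1-3), of 2 f u] e f u uvw yv by (auto simp: insert_commute)
    next
      case 3
      then have "e = f" using optimal_uncoloured_unique[OF c e(1,2), of v f] e f yv by auto
      then show ?thesis using e f uvw by auto
    qed
  next
    assume yw: "y = w"
    from cf show ?thesis
    proof cases
      case 1
      then show ?thesis using rotate_once[OF c e(1,2) e', of 1 f u] e f u uvw yw by (auto simp: insert_commute)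
    next
      case 2
      then show ?thesis using e f yw by (auto simp: misses_def)
    next
      case 3
      then have "e = f" using optimal_uncoloured_unique[OF c e(1,2), of w f] e f yw by auto
      then show ?thesis using e f uvw by auto
    qed
  next
    fix g assume g: "g \<in> edges G" "c g = 2" "ends G g = {v, y}" "y \<noteq> v"
    from cf show ?thesis
    proof cases
      case 1
      then show ?thesis
        using rotate_twice[OF c e(1-3), of 1 2 g y f u] e f u uvw g by (auto simp: insert_commute)
    next
      case 2
      then have "f = g" using same_colour_eq[OF col f(1) g(1), of y] f g by auto
      then show ?thesis using f g uvw by (auto simp: doubleton_eq_iff)
    next
      case 3
      \<comment> \<open>An uncoloured edge at \<open>y\<close> requires a missed colour, but the
        third core vertex misses none.\<close>
      then obtain i where i: "i < 3" "misses c i y"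
        using uncoloured_end_misses[OF col f(1), of y] f by auto
      have "i \<noteq> 0" using core_not_misses_0[OF c y] i by metis
      moreover have "i \<noteq> 1" using Kempe_neighbour_full[OF c e(1-3), of 1 2 g y] e g i by auto
      moreover have "i \<noteq> 2" using g i by (auto simp: misses_def)
      ultimately show ?thesis using i by linarith
    qed
  qed
qed

section \<open>Edges at vertices missing colour 0\<close>

lemma no_edge_between_missing_0:
  assumes c: "optimal c" and f: "f \<in> edges G" "ends G f = {u, v}" and m: "misses c 0 u" "misses c 0 v"
  shows False
proof -
  have "colouring (c(f := 0))"
    using colouring_upd[OF optimal_colouring[OF c], of 0 f] f m by auto
  then have "card (colour_class (c(f := 0)) 0) \<le> card (colour_class c 0)"
    using c unfolding optimal_def by blast
  moreover have "c f \<noteq> 0" using f m by (auto simp: misses_def)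
  ultimately show False using card_colour_class_upd[OF f(1), of c 0 0] by simp
qed

text \<open>For distinct \<open>u1\<close> and \<open>u2\<close>, the path \<open>u1\<close>,
  \<open>x\<close>, \<open>y\<close>, \<open>u2\<close> would augment class 0; the colours lost on
  other edges do not count against this. For \<open>u1 = u2\<close> the walk closes up to a triangle
  and nothing is gained.\<close>

lemma no_augmenting_path:
  assumes c: "optimal c" and g: "g \<in> edges G" "c g = 0" "ends G g = {x, y}"
    and f1: "f1 \<in> edges G" "ends G f1 = {u1, x}" "misses c 0 u1"
    and f2: "f2 \<in> edges G" "ends G f2 = {u2, y}" "misses c 0 u2"
  shows "u1 = u2"
proof (rule ccontr)
  assume ne: "u1 \<noteq> u2"
  have col: "colouring c" using c by (rule optimal_colouring)
  have "\<not> misses c 0 x" "\<not> misses c 0 y" using g by (auto simp: misses_def)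
  then have u: "u1 \<noteq> x" "u1 \<noteq> y" "u2 \<noteq> x" "u2 \<noteq> y" using f1 f2 by auto
  have xy: "x \<noteq> y" using card_ends[OF g(1)] g by auto
  have ff: "f1 \<noteq> f2" "f1 \<noteq> g" "f2 \<noteq> g" using f1 f2 g u ne by (auto simp: doubleton_eq_iff)
  have c12: "c f1 \<noteq> 0" "c f2 \<noteq> 0" using f1 f2 by (auto simp: misses_def)
  let ?c1 = "c(g := 3)"
  have m: "misses ?c1 0 x" "misses ?c1 0 y"
    using misses_uncolour[OF col g(1)] g by auto
  have "misses ?c1 0 u1" "misses ?c1 0 u2" using f1 f2 by (auto simp: misses_def)
  then have col1: "colouring (?c1(f1 := 0))"
    using colouring_upd[OF colouring_uncolour[OF col, of g], of 0 f1] f1 m by auto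
  have "misses (?c1(f1 := 0)) 0 y" "misses (?c1(f1 := 0)) 0 u2"
    using m f1 f2 u ne xy by (auto simp: misses_def)
  then have "colouring (?c1(f1 := 0, f2 := 0))"
    using colouring_upd[OF col1, of 0 f2] f2 by auto
  then have "card (colour_class (?c1(f1 := 0, f2 := 0)) 0) \<le> card (colour_class c 0)"
    using c unfolding optimal_def by blast
  then show False
    using card_colour_class_upd[OF g(1), of c 3 0] card_colour_class_upd[OF f1(1), of ?c1 0 0]
      card_colour_class_upd[OF f2(1), of "?c1(f1 := 0)" 0 0] g ff c12 by simp
qed

text \<open>
  Exchanges the colour-0 edge \<open>g\<close> at \<open>x\<close> for \<open>f\<close>; if \<open>f\<close> had colour \<open>k\<close>, then the uncoloured
  edge \<open>h\<close> can take that colour, so nothing is lost.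
\<close>
lemma swap_optimal:
  assumes c: "optimal c" and u: "misses c 0 u"
    and h: "h \<in> edges G" "c h = 3" "ends G h = {u, w}" "misses c k w" "k \<in> {1, 2}"
    and f: "f \<in> edges G" "ends G f = {u, x}" "c f = 3 \<or> c f = k"
    and g: "g \<in> edges G" "c g = 0" "ends G g = {x, y}"
  shows "\<exists>c'. optimal c' \<and> colour_class c' 0 = insert f (colour_class c 0 - {g}) \<and>
    misses c' 0 y \<and> (core c y \<longrightarrow> core c' y)"
proof -
  have col: "colouring c" using c by (rule optimal_colouring)
  have nx: "\<not> misses c 0 x" "\<not> misses c 0 y" using g by (auto simp: misses_def)
  have ux: "u \<noteq> x" "u \<noteq> y" using nx u by auto
  have xy: "x \<noteq> y" using card_ends[OF g(1)] g by auto
  have uw: "u \<noteq> w" using card_ends[OF h(1)] h by auto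
  have fh: "c f = 3 \<longleftrightarrow> f = h"
    using optimal_uncoloured_unique[OF c, of f u h] f h by auto
  have gf: "g \<noteq> f" "g \<noteq> h" using f g h by auto
  define c2 where "c2 = c(g := 3, f := 0)"
  \<comment> \<open>For \<open>f = h\<close> the number of coloured edges is already balanced:
    \<open>f\<close> becomes coloured and \<open>g\<close> uncoloured.\<close>
  define c' where "c' = (if f = h then c2 else c2(h := k))"
  have "misses (c(g := 3)) 0 u" using u by (auto simp: misses_def)
  moreover have x0: "misses (c(g := 3)) 0 x" "misses (c(g := 3)) 0 y"
    using misses_uncolour[OF col g(1)] g by auto
  ultimately have col2: "colouring c2"
    unfolding c2_def using colouring_upd[OF colouring_uncolour[OF col, of g], of 0 f] f by auto
  have col': "colouring c'"
  proof (cases "f = h")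
    case True
    then show ?thesis using col2 by (simp add: c'_def)
  next
    case False
    then have cf: "c f = k" using f fh by blast
    have "misses c2 k w" using h by (auto simp: misses_def c2_def)
    moreover have "misses (c(f := 3)) k u"
      using misses_uncolour[OF col f(1), of u] cf f h by auto
    then have "misses c2 k u" using h(5) by (auto simp: misses_def c2_def)
    ultimately have "colouring (c2(h := k))"
      using colouring_upd[OF col2, of k h] h by auto
    then show ?thesis using False by (simp add: c'_def)
  qed
  have cf0: "c f \<noteq> 0" using f h by auto
  have cl: "colour_class c' 0 = insert f (colour_class c 0 - {g})"
    using f g h gf cf0 by (auto simp: colour_class_def c'_def c2_def)
  have card0: "card (colour_class c' 0) = card (colour_class c 0)"
  proof -
    have "f \<notin> colour_class c 0" "g \<in> colour_class c 0" using cf0 g by (auto simp: colour_class_def)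
    then show ?thesis unfolding cl using card_Suc_Diff1[of "colour_class c 0" g] by simp
  qed
  have "card (coloured c') = card (coloured c)"
  proof (cases "f = h")
    case True
    then show ?thesis
      using card_coloured_upd[OF g(1), of c 3] card_coloured_upd[OF f(1), of "c(g := 3)" 0] g h gf
      by (simp add: c'_def c2_def)
  next
    case False
    then have cf: "c f = k" using f fh by blast
    show ?thesis
      using card_coloured_upd[OF g(1), of c 3] card_coloured_upd[OF f(1), of "c(g := 3)" 0]
        card_coloured_upd[OF h(1), of c2 k] g h gf False cf
      by (auto simp: c'_def c2_def)
  qed
  then have opt: "optimal c'" using optimalI[OF c col' card0] by blast
  have y0: "misses c' 0 y" using x0(2) f h ux xy by (auto simp: misses_def c'_def c2_def)
  \<comment> \<open>Only \<open>f\<close>, \<open>g\<close> and \<open>h\<close> change. Neither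
    \<open>u\<close> nor \<open>w\<close> is an end of \<open>e\<close>, the latter because
    uncoloured edges do not meet, so the configuration that makes \<open>y\<close> a core vertex
    survives.\<close>
  have "core c' y" if yc: "core c y"
  proof -
    obtain e v t where e: "e \<in> edges G" "c e = 3" "ends G e = {v, t}" "v \<noteq> t" "misses c 1 v" "misses c 2 t"
      and yy: "y = v \<or> y = t \<or> (\<exists>g\<in>edges G. c g = 2 \<and> ends G g = {v, y} \<and> y \<noteq> v)"
      using yc unfolding core_def by blast
    have cv: "core c v" "core c t" using e unfolding core_def by blast+
    have uv: "u \<noteq> v" "u \<noteq> t" using core_not_misses_0[OF c] cv u by blast+
    have ne: "e \<noteq> f" "e \<noteq> h" "e \<noteq> g" using e f h g uv by auto
    have wv: "w \<noteq> v" "w \<noteq> t"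
      using optimal_uncoloured_unique[OF c e(1,2), of w h] e h ne by auto
    have "c' e = 3" using e ne by (simp add: c'_def c2_def)
    moreover have "misses c' 1 v" "misses c' 2 t"
      using e h uv wv by (auto simp: misses_def c'_def c2_def)
    moreover have "y = v \<or> y = t \<or> (\<exists>g\<in>edges G. c' g = 2 \<and> ends G g = {v, y} \<and> y \<noteq> v)"
      using yy
    proof (elim disjE bexE conjE)
      fix l assume l: "l \<in> edges G" "c l = 2" "ends G l = {v, y}" "y \<noteq> v"
      have "l \<noteq> f" "l \<noteq> g" "l \<noteq> h" using l f g h uv ux by auto
      then have "c' l = 2" using l by (simp add: c'_def c2_def)
      then show ?thesis using l by blast
    qed auto
    ultimately show ?thesis using e unfolding core_def by blast
  qed
  then show ?thesis using opt cl y0 by blast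
qed

lemma missing_0_uncoloured:
  assumes c: "optimal c" and u: "u \<in> verts G" "misses c 0 u"
  obtains h w k where "h \<in> edges G" "c h = 3" "ends G h = {u, w}" "misses c k w" "k \<in> {1, 2}"
proof -
  have col: "colouring c" using c by (rule optimal_colouring)
  obtain h w where h: "h \<in> edges G" "c h = 3" "ends G h = {u, w}"
    using missing_has_uncoloured[OF col u(1) _ u(2)] by (metis zero_less_numeral)
  obtain k where k: "k < 3" "misses c k w" using uncoloured_end_misses[OF col h(1,2), of w] h by auto
  have "k \<noteq> 0" using no_edge_between_missing_0[OF c h(1,3) u(2)] k by metis
  then have "k \<in> {1, 2}" using k by auto
  then show ?thesis using that h k by blast
qed

text \<open>If one of the edges had colour 3 or \<open>k\<close>, then \<open>swap_optimal\<close>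
  would produce a core vertex missing 0. So both have the one remaining colour.\<close>

lemma exceptional_edge_unique:
  assumes c: "optimal c" and u: "u \<in> verts G" "misses c 0 u"
    and f1: "f1 \<in> edges G" "ends G f1 = {u, x1}" "g1 \<in> edges G" "c g1 = 0" "ends G g1 = {x1, y1}" "core c y1"
    and f2: "f2 \<in> edges G" "ends G f2 = {u, x2}" "g2 \<in> edges G" "c g2 = 0" "ends G g2 = {x2, y2}" "core c y2"
  shows "f1 = f2"
proof -
  have col: "colouring c" using c by (rule optimal_colouring)
  obtain h w k where h: "h \<in> edges G" "c h = 3" "ends G h = {u, w}" "misses c k w" "k \<in> {1, 2}"
    using missing_0_uncoloured[OF c u] .
  have *: "c f \<noteq> 3 \<and> c f \<noteq> k" if "f \<in> edges G" "ends G f = {u, x}" "g \<in> edges G" "c g = 0" "ends G g = {x, y}"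
    "core c y" for f g x y
    using swap_optimal[OF c u(2) h that(1,2) _ that(3-5)] core_not_misses_0 that by blast
  have 1: "c f1 \<noteq> 3" "c f1 \<noteq> k" "c f1 \<noteq> 0" "c f1 \<le> 3"
    using *[OF f1] u f1 col by (auto simp: misses_def colour_le)
  have 2: "c f2 \<noteq> 3" "c f2 \<noteq> k" "c f2 \<noteq> 0" "c f2 \<le> 3"
    using *[OF f2] u f2 col by (auto simp: misses_def colour_le)
  have "c f1 = c f2" "c f1 < 3" using 1 2 h(5) by auto
  then show ?thesis using same_colour_eq[OF col f1(1) f2(1), of u] f1 f2 by auto
qed

text \<open>
  Maximised among the optimal colourings, to exclude a double edge from a vertex missing colour 0
  into a triangle.
\<close>
definition parallel_in_class_0 where
  "parallel_in_class_0 c = {e \<in> colour_class c 0. \<exists>f\<in>edges G. f \<noteq> e \<and> ends G f = ends G e}"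

text \<open>The parallel edges have different colours among 1, 2, 3, two of which permit the
  exchange of \<open>swap_optimal\<close>; so it applies to one of them. Degree 3 at
  \<open>x\<close> leaves \<open>g\<close> without a parallel edge, hence the exchange would enlarge
  \<open>parallel_in_class_0\<close>.\<close>

lemma no_fat_triangle:
  assumes c: "optimal c" and max: "\<And>c'. optimal c' \<Longrightarrow> card (parallel_in_class_0 c') \<le> card (parallel_in_class_0 c)"
    and u: "u \<in> verts G" "misses c 0 u"
    and f: "f1 \<in> edges G" "f2 \<in> edges G" "f1 \<noteq> f2" "ends G f1 = {u, x}" "ends G f2 = {u, x}"
    and g: "g \<in> edges G" "c g = 0" "ends G g = {x, y}"
  shows False
proof -
  have col: "colouring c" using c by (rule optimal_colouring)
  obtain h w k where h: "h \<in> edges G" "c h = 3" "ends G h = {u, w}" "misses c k w" "k \<in> {1, 2}"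
    using missing_0_uncoloured[OF c u] .
  have nx: "\<not> misses c 0 x" "\<not> misses c 0 y" using g by (auto simp: misses_def)
  have ux: "u \<noteq> x" "u \<noteq> y" using nx u by auto
  have xy: "x \<noteq> y" using card_ends[OF g(1)] g by auto
  have "c f1 \<noteq> 0" "c f2 \<noteq> 0" "c f1 \<le> 3" "c f2 \<le> 3"
    using u f col by (auto simp: misses_def colour_le)
  moreover have "c f1 \<noteq> c f2"
    using same_colour_eq[OF col f(1,2), of u] optimal_uncoloured_unique[OF c f(1) _ _ f(2), of u] f
      \<open>c f1 \<le> 3\<close> by (cases "c f1 = 3") auto
  ultimately have "c f1 = 3 \<or> c f1 = k \<or> c f2 = 3 \<or> c f2 = k" using h(5) by auto
  then obtain f f' where ff: "f \<in> edges G" "ends G f = {u, x}" "c f = 3 \<or> c f = k"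
     "f' \<in> edges G" "ends G f' = {u, x}" "f' \<noteq> f"
    using f by metis
  obtain c' where c': "optimal c'" "colour_class c' 0 = insert f (colour_class c 0 - {g})"
    using swap_optimal[OF c u(2) h ff(1-3) g] by blast
  have "\<not> (\<exists>g'\<in>edges G. g' \<noteq> g \<and> ends G g' = ends G g)"
  proof
    assume "\<exists>g'\<in>edges G. g' \<noteq> g \<and> ends G g' = ends G g"
    then obtain g' where g': "g' \<in> edges G" "g' \<noteq> g" "ends G g' = {x, y}" using g by auto
    have "{f, f', g, g'} \<subseteq> {e \<in> edges G. x \<in> ends G e}" using ff g g' by auto
    then have "card {f, f', g, g'} \<le> card {e \<in> edges G. x \<in> ends G e}"
      using finite_edges by (intro card_mono) auto
    then have "card {f, f', g, g'} \<le> 3"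
      using card_incident[of x] ends_subset[OF g(1)] g by auto
    moreover have "f \<noteq> g" "f' \<noteq> g" "f \<noteq> g'" "f' \<noteq> g'" using ff g g' ux by auto
    ultimately show False using ff g' by simp
  qed
  then have "parallel_in_class_0 c' = insert f (parallel_in_class_0 c)"
    using c' ff unfolding parallel_in_class_0_def by auto
  moreover have "c f \<noteq> 0" using ff h by auto
  then have "f \<notin> parallel_in_class_0 c" unfolding parallel_in_class_0_def colour_class_def by simp
  moreover have "finite (parallel_in_class_0 c)" unfolding parallel_in_class_0_def by simp
  ultimately show False using max[OF c'(1)] by simp
qed

section \<open>Counting core vertices and vertices missing colour 0\<close>

text \<open>Uncoloured edges pair each vertex missing 0 with one missing 1 or 2. The remaining
  vertices missing 1 are paired with the remaining ones missing 2; \<open>m\<close> is the number of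
  these pairs, and each provides three core vertices.\<close>

lemma card_core:
  assumes c: "optimal c"
  shows "\<exists>m. card {x \<in> verts G. misses c 1 x} + card {x \<in> verts G. misses c 2 x} =
    card {x \<in> verts G. misses c 0 x} + 2 * m \<and> 3 * m \<le> card {x \<in> verts G. core c x}"
proof -
  have col: "colouring c" using c by (rule optimal_colouring)
  define D where "D i = {x \<in> verts G. misses c i x}" for i
  have finD: "finite (D i)" for i using finite_verts by (simp add: D_def)
  have D_disj: "i = j" if "x \<in> D i" "x \<in> D j" "i < 3" "j < 3" for x i j
    using optimal_misses_unique[OF c, of x i j] that by (simp add: D_def)
  have "\<exists>y. \<exists>e\<in>edges G. c e = 3 \<and> ends G e = {x, y} \<and> y \<noteq> x" if x: "x \<in> (\<Union>i<3. D i)" for x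
  proof -
    obtain i where i: "i < 3" "x \<in> verts G" "misses c i x" using x by (auto simp: D_def)
    show ?thesis using missing_has_uncoloured[OF col i(2,1,3)] by metis
  qed
  \<comment> \<open>\<open>p\<close> sends a vertex to its partner along the uncoloured
    edge.\<close>
  then obtain p where "\<And>x. x \<in> (\<Union>i<3. D i) \<Longrightarrow>
      \<exists>e\<in>edges G. c e = 3 \<and> ends G e = {x, p x} \<and> p x \<noteq> x"
    by metis
  then have p: "\<exists>e\<in>edges G. c e = 3 \<and> ends G e = {x, p x} \<and> p x \<noteq> x"
    if "i < 3" "x \<in> D i" for i x
    using that by blast
  have pD: "\<exists>j<3. j \<noteq> i \<and> p x \<in> D j" if i: "i < 3" "x \<in> D i" for i x
  proof -
    obtain e where e: "e \<in> edges G" "c e = 3" "ends G e = {x, p x}" using p[OF i] by blast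
    obtain j where j: "j < 3" "misses c j (p x)" using uncoloured_end_misses[OF col e(1,2), of "p x"] e by auto
    have "j \<noteq> i" using optimal_no_common_miss[OF c e i(1)] j i by (auto simp: D_def)
    then show ?thesis using j e ends_subset[OF e(1)] by (auto simp: D_def)
  qed
  have pp: "p (p x) = x" if i: "i < 3" "x \<in> D i" for i x
  proof -
    obtain e where e: "e \<in> edges G" "c e = 3" "ends G e = {x, p x}" "p x \<noteq> x" using p[OF i] by blast
    obtain j where j: "j < 3" "p x \<in> D j" using pD[OF i] by blast
    obtain f where f: "f \<in> edges G" "c f = 3" "ends G f = {p x, p (p x)}" "p (p x) \<noteq> p x" using p[OF j] by blast
    have "e = f" using optimal_uncoloured_unique[OF c e(1,2) _ f(1,2), of "p x"] e f by auto
    then show ?thesis using e f by (auto simp: doubleton_eq_iff)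
  qed
  \<comment> \<open>For \<open>i\<close> equal to 1 or 2, the partners of the vertices in
    \<open>D' i\<close> miss the other of these two colours.\<close>
  define D' where "D' i = {x \<in> D i. p x \<notin> D 0}" for i
  have finD': "finite (D' i)" for i using finD by (simp add: D'_def)
  have D_split: "D i = D' i \<union> (D i \<inter> p ` D 0)" if i: "i = 1 \<or> i = 2" for i
  proof -
    have "x \<in> p ` D 0" if "x \<in> D i" "p x \<in> D 0" for x
    proof -
      have "p (p x) = x" using pp[of i x] that i by auto
      then show ?thesis using that(2) by (metis imageI)
    qed
    then show ?thesis unfolding D'_def by blast
  qed
  have "p x \<in> D 1 \<union> D 2" if "x \<in> D 0" for x
    using pD[of 0 x] that by (auto simp: numeral_3_eq_3 less_Suc_eq numeral_2_eq_2)
  then have pU: "p ` D 0 = (D 1 \<inter> p ` D 0) \<union> (D 2 \<inter> p ` D 0)" by blast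
  have "inj_on p (D 0)" using pp[of 0] by (intro inj_on_inverseI[of _ p]) auto
  then have "card (D 0) = card (p ` D 0)" by (simp add: card_image)
  also have "\<dots> = card (D 1 \<inter> p ` D 0) + card (D 2 \<inter> p ` D 0)"
    by (subst pU, rule card_Un_disjoint) (use finD D_disj[of _ 1 2] in auto)
  finally have c0: "card (D 0) = card (D 1 \<inter> p ` D 0) + card (D 2 \<inter> p ` D 0)" .
  have "D' i \<inter> (D i \<inter> p ` D 0) = {}" for i
    using pp[of 0] by (auto simp: D'_def)
  then have "card (D i) = card (D' i) + card (D i \<inter> p ` D 0)" if "i = 1 \<or> i = 2" for i
    using card_Un_disjoint[of "D' i" "D i \<inter> p ` D 0"] D_split[OF that] finD finD' by simp
  then have c12: "card (D 1) + card (D 2) = card (D 0) + (card (D' 1) + card (D' 2))"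
    using c0 by simp
  have p': "p x \<in> D' j" if x: "x \<in> D' i" and ij: "(i, j) = (1, 2) \<or> (i, j) = (2, 1)" for i j x
  proof -
    have xi: "x \<in> D i" "i < 3" "p x \<notin> D 0" using x ij by (auto simp: D'_def)
    obtain l where l: "l < 3" "l \<noteq> i" "p x \<in> D l" using pD[OF xi(2,1)] by blast
    have "l \<noteq> 0" using l xi by metis
    then have "l = j" using l ij by auto
    moreover have "x \<notin> D 0" using D_disj[of x i 0] xi ij by auto
    ultimately show ?thesis using l pp[OF xi(2,1)] by (simp add: D'_def)
  qed
  have inj: "inj_on p (D' i)" if "i < 3" for i
    using pp[OF that] by (intro inj_on_inverseI[of _ p]) (auto simp: D'_def)
  have "card (D' 1) \<le> card (D' 2)"
    using p'[of _ 1 2] inj[of 1] finD' by (intro card_inj_on_le[of p]) auto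
  moreover have "card (D' 2) \<le> card (D' 1)"
    using p'[of _ 2 1] inj[of 2] finD' by (intro card_inj_on_le[of p]) auto
  ultimately have c': "card (D' 2) = card (D' 1)" by simp
  have "\<exists>y. \<exists>g\<in>edges G. c g = 2 \<and> ends G g = {x, y} \<and> y \<noteq> x" if x: "x \<in> D' 1" for x
  proof -
    have "x \<notin> D 2" using D_disj[of x 1 2] x by (auto simp: D'_def)
    then obtain g where "g \<in> edges G" "c g = 2" "x \<in> ends G g"
      using x by (auto simp: D'_def D_def misses_def)
    then show ?thesis using ends_obtain[of g x] by metis
  qed
  then obtain q where q: "\<And>x. x \<in> D' 1 \<Longrightarrow> \<exists>g\<in>edges G. c g = 2 \<and> ends G g = {x, q x} \<and> q x \<noteq> x"
    by metis
  have D1: "\<exists>e\<in>edges G. c e = 3 \<and> ends G e = {x, p x} \<and> p x \<noteq> x \<and> misses c 1 x \<and> misses c 2 (p x)"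
    if "x \<in> D' 1" for x
    using p[of 1 x] p'[of x 1 2] that by (auto simp: D'_def D_def)
  \<comment> \<open>Missing neither 1 nor 2, the third core vertex \<open>q x\<close> is not an end
    of any of the pairs.\<close>
  have q_full: "q x \<notin> D 1" "q x \<notin> D 2" if x: "x \<in> D' 1" for x
  proof -
    obtain e where e: "e \<in> edges G" "c e = 3" "ends G e = {x, p x}" "misses c 1 x" "misses c 2 (p x)"
      using D1[OF x] by blast
    obtain g where g: "g \<in> edges G" "c g = 2" "ends G g = {x, q x}" "q x \<noteq> x" using q[OF x] by blast
    show "q x \<notin> D 1" using Kempe_neighbour_full[OF c e(1-3), of 1 2 g "q x"] e g by (auto simp: D_def)
    show "q x \<notin> D 2" using g by (auto simp: D_def misses_def)
  qed
  have "inj_on q (D' 1)"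
  proof (rule inj_onI)
    fix x y assume x: "x \<in> D' 1" and y: "y \<in> D' 1" and eq: "q x = q y"
    obtain g where g: "g \<in> edges G" "c g = 2" "ends G g = {x, q x}" "q x \<noteq> x" using q[OF x] by blast
    obtain h where h: "h \<in> edges G" "c h = 2" "ends G h = {y, q y}" "q y \<noteq> y" using q[OF y] by blast
    have "g = h" using same_colour_eq[OF col g(1) h(1), of "q x"] g h eq by auto
    then have "{x, q x} = {y, q x}" using g h eq by metis
    then show "x = y" by (auto simp: doubleton_eq_iff)
  qed
  then have cq: "card (q ` D' 1) = card (D' 1)" by (simp add: card_image)
  have "card (D' 1 \<union> D' 2 \<union> q ` D' 1) = card (D' 1) + card (D' 2) + card (q ` D' 1)"
  proof -
    have "D' 1 \<inter> D' 2 = {}" using D_disj[of _ 1 2] by (auto simp: D'_def)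
    moreover have "(D' 1 \<union> D' 2) \<inter> q ` D' 1 = {}" using q_full by (auto simp: D'_def)
    ultimately show ?thesis using finD' by (simp add: card_Un_disjoint)
  qed
  then have "3 * card (D' 1) = card (D' 1 \<union> D' 2 \<union> q ` D' 1)" using c' cq by simp
  also have "\<dots> \<le> card {x \<in> verts G. core c x}"
  proof (rule card_mono)
    show "finite {x \<in> verts G. core c x}" using finite_verts by simp
    have "core c x \<and> core c (p x) \<and> core c (q x) \<and> q x \<in> verts G" if x: "x \<in> D' 1" for x
    proof -
      obtain e where e: "e \<in> edges G" "c e = 3" "ends G e = {x, p x}" "p x \<noteq> x" "misses c 1 x" "misses c 2 (p x)"
        using D1[OF x] by blast
      obtain g where g: "g \<in> edges G" "c g = 2" "ends G g = {x, q x}" "q x \<noteq> x" using q[OF x] by blast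
      have "core c y" if "y = x \<or> y = p x \<or> y = q x" for y
        unfolding core_def by (intro exI[of _ e] exI[of _ x] exI[of _ "p x"]) (use e g that in auto)
      then show ?thesis using g ends_subset[OF g(1)] by auto
    qed
    moreover have "x \<in> p ` D' 1" if "x \<in> D' 2" for x
    proof -
      have "p x \<in> D' 1" using p'[of x 2 1] that by simp
      moreover have "p (p x) = x" using pp[of 2 x] that by (simp add: D'_def)
      ultimately show ?thesis by (metis imageI)
    qed
    ultimately show "D' 1 \<union> D' 2 \<union> q ` D' 1 \<subseteq> {x \<in> verts G. core c x}"
      by (auto simp: D'_def D_def)
  qed
  finally have "3 * card (D' 1) \<le> card {x \<in> verts G. core c x}" .
  then show ?thesis using c12 c' unfolding D_def by (intro exI[of _ "card (D' 1)"]) simp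
qed

text \<open>With \<open>k\<close> for the size of \<open>U\<close>, the count finds at least
  \<open>k + 3k - k/2\<close> vertices outside the core, since \<open>card W + card W2 = 3k\<close>
  and \<open>2 * card L <= k\<close>; doubling clears the fraction.\<close>

lemma card_missing_0_and_core:
  assumes c: "optimal c"
    and max: "\<And>c'. optimal c' \<Longrightarrow> card (parallel_in_class_0 c') \<le> card (parallel_in_class_0 c)"
  shows "7 * card {x \<in> verts G. misses c 0 x} + 2 * card {x \<in> verts G. core c x} \<le> 2 * card (verts G)"
proof -
  have col: "colouring c" using c by (rule optimal_colouring)
  define U where "U = {x \<in> verts G. misses c 0 x}"
  define X where "X = {x \<in> verts G. core c x}"
  define F where "F = {e \<in> edges G. ends G e \<inter> U \<noteq> {}}"
  define S where "S x = {e \<in> F. x \<in> ends G e}" for x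
  define W where "W = {x \<in> verts G. x \<notin> U \<and> S x \<noteq> {}}"
  define W2 where "W2 = {x \<in> W. card (S x) = 2}"
  have fin: "finite U" "finite X" "finite W" "finite W2" "finite F" "finite (S x)" for x
    using finite_verts finite_edges by (auto simp: U_def X_def W_def W2_def F_def S_def)
  have F: "\<exists>u x. ends G e = {u, x} \<and> u \<in> U \<and> x \<in> W \<and> x \<notin> U" if e: "e \<in> F" for e
  proof -
    obtain u where u: "u \<in> ends G e" "u \<in> U" "e \<in> edges G" using e by (auto simp: F_def)
    obtain x where x: "ends G e = {u, x}" "x \<in> verts G" using ends_obtain[OF u(3,1)] by blast
    have "x \<notin> U" using no_edge_between_missing_0[OF c u(3) x(1)] u by (auto simp: U_def)
    moreover have "e \<in> S x" using e x by (auto simp: S_def)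
    ultimately show ?thesis using x u by (auto simp: W_def)
  qed
  \<comment> \<open>Each edge of \<open>F\<close> has only one end in \<open>U\<close>, so nothing
    is counted twice.\<close>
  have "card F = (\<Sum>u\<in>U. card {e \<in> edges G. u \<in> ends G e})"
  proof -
    have "F = (\<Union>u\<in>U. {e \<in> edges G. u \<in> ends G e})" by (auto simp: F_def)
    moreover have "{e \<in> edges G. u \<in> ends G e} \<inter> {e \<in> edges G. v \<in> ends G e} = {}"
      if "u \<in> U" "v \<in> U" "u \<noteq> v" for u v
    proof -
      have False if e: "e \<in> edges G" "u \<in> ends G e" "v \<in> ends G e" for e
      proof -
        have "e \<in> F" using e \<open>u \<in> U\<close> by (auto simp: F_def)
        then show False using F[of e] \<open>u \<in> U\<close> \<open>v \<in> U\<close> \<open>u \<noteq> v\<close> e by auto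
      qed
      then show ?thesis by blast
    qed
    ultimately show ?thesis using fin finite_edges by (simp add: card_UN_disjoint)
  qed
  then have F1: "card F = 3 * card U" using card_incident by (simp add: U_def)
  have F2: "card F = (\<Sum>x\<in>W. card (S x))"
  proof -
    have "F = (\<Union>x\<in>W. S x)" using F unfolding S_def by blast
    moreover have "S x \<inter> S y = {}" if "x \<in> W" "y \<in> W" "x \<noteq> y" for x y
    proof -
      have False if e: "e \<in> F" "x \<in> ends G e" "y \<in> ends G e" for e
        using F[OF e(1)] \<open>x \<in> W\<close> \<open>y \<in> W\<close> \<open>x \<noteq> y\<close> e by (auto simp: W_def)
      then show ?thesis by (auto simp: S_def)
    qed
    ultimately show ?thesis using fin by (simp add: card_UN_disjoint)
  qed
  have "\<exists>y. \<exists>g\<in>edges G. c g = 0 \<and> ends G g = {x, y}" if x: "x \<in> W" for x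
  proof -
    obtain g where "g \<in> edges G" "c g = 0" "x \<in> ends G g"
      using x by (auto simp: W_def U_def misses_def)
    then show ?thesis using ends_obtain[of g x] by metis
  qed
  then obtain m where m: "\<And>x. x \<in> W \<Longrightarrow> \<exists>g\<in>edges G. c g = 0 \<and> ends G g = {x, m x}"
    by metis
  have mU: "m x \<notin> U" "m x \<in> verts G" if x: "x \<in> W" for x
    using m[OF x] ends_subset by (auto simp: U_def misses_def)
  \<comment> \<open>The edge of colour 0 at \<open>x\<close> takes one of the three places, as it
    cannot meet \<open>U\<close>.\<close>
  have S_le: "card (S x) \<le> 2" if x: "x \<in> W" for x
  proof -
    obtain g where g: "g \<in> edges G" "c g = 0" "ends G g = {x, m x}" using m[OF x] by blast
    have "g \<notin> F" using g by (auto simp: F_def U_def misses_def)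
    then have "insert g (S x) \<subseteq> {e \<in> edges G. x \<in> ends G e}" "g \<notin> S x"
      using g by (auto simp: S_def F_def)
    then have "card (insert g (S x)) \<le> 3"
      using card_mono[of "{e \<in> edges G. x \<in> ends G e}" "insert g (S x)"] finite_edges
        card_incident[of x] x by (simp add: W_def)
    then show ?thesis using \<open>g \<notin> S x\<close> fin by simp
  qed
  have "card (S x) = 1 + (if x \<in> W2 then 1 else 0)" if x: "x \<in> W" for x
  proof -
    have "card (S x) \<noteq> 0" using x fin by (simp add: W_def)
    then show ?thesis using S_le[OF x] x by (auto simp: W2_def)
  qed
  then have "(\<Sum>x\<in>W. card (S x)) = (\<Sum>x\<in>W. 1 + (if x \<in> W2 then 1 else 0))" by simp
  also have "\<dots> = (\<Sum>x\<in>W. 1) + (\<Sum>x\<in>W. if x \<in> W2 then 1 else 0)" by (rule sum.distrib)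
  also have "\<dots> = card W + card (W \<inter> W2)" using fin by (simp add: sum.If_cases)
  also have "W \<inter> W2 = W2" by (auto simp: W2_def)
  finally have W3: "3 * card U = card W + card W2" using F1 F2 by simp
  have adj: "\<exists>u\<in>U. ends G e = {u, x}" if "e \<in> S x" "x \<in> W" for e x
    using F[of e] that by (auto simp: S_def W_def)
  \<comment> \<open>An edge from \<open>U\<close> to \<open>m x\<close> completes an augmenting path
    unless both edges of \<open>S x\<close> start at the same vertex of \<open>U\<close> as it does;
    but then they are parallel.\<close>
  have mW: "m x \<notin> W" if x: "x \<in> W2" for x
  proof
    assume mx: "m x \<in> W"
    have xW: "x \<in> W" using x by (simp add: W2_def)
    obtain g where g: "g \<in> edges G" "c g = 0" "ends G g = {x, m x}" using m[OF xW] by blast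
    obtain f where f: "f \<in> S (m x)" using mx by (auto simp: W_def)
    obtain v where v: "v \<in> U" "ends G f = {v, m x}" using adj[OF f mx] by blast
    have "\<exists>e1 e2. S x = {e1, e2} \<and> e1 \<noteq> e2" using x by (simp add: W2_def card_2_iff)
    then obtain e1 e2 where e: "e1 \<in> S x" "e2 \<in> S x" "e1 \<noteq> e2" by blast
    obtain u1 where u1: "u1 \<in> U" "ends G e1 = {u1, x}" using adj[OF e(1) xW] by blast
    obtain u2 where u2: "u2 \<in> U" "ends G e2 = {u2, x}" using adj[OF e(2) xW] by blast
    have E: "e1 \<in> edges G" "e2 \<in> edges G" "f \<in> edges G" using e f by (auto simp: S_def F_def)
    have "u1 = v" "u2 = v"
      using no_augmenting_path[OF c g E(1) u1(2) _ E(3) v(2)]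
        no_augmenting_path[OF c g E(2) u2(2) _ E(3) v(2)] u1 u2 v by (auto simp: U_def)
    then show False
      using no_fat_triangle[OF c max, of v e1 e2 x g "m x"] v e E u1 u2 g by (auto simp: U_def)
  qed
  have inj: "inj_on m W"
  proof (rule inj_onI)
    fix x y assume x: "x \<in> W" and y: "y \<in> W" and eq: "m x = m y"
    obtain g where g: "g \<in> edges G" "c g = 0" "ends G g = {x, m x}" using m[OF x] by blast
    obtain h where h: "h \<in> edges G" "c h = 0" "ends G h = {y, m y}" using m[OF y] by blast
    have "g = h" using same_colour_eq[OF col g(1) h(1), of "m x"] g h eq by auto
    then have "{x, m x} = {y, m x}" using g h eq by metis
    then show "x = y" by (auto simp: doubleton_eq_iff)
  qed
  define L where "L = {x \<in> W2. m x \<in> X}"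
  have LW: "L \<subseteq> W" "L \<subseteq> W2" by (auto simp: L_def W2_def)
  have finL: "finite L" using LW fin finite_subset by blast
  \<comment> \<open>Each \<open>x\<close> in \<open>L\<close> receives two edges from
    \<open>U\<close>, and by \<open>exceptional_edge_unique\<close> a vertex of \<open>U\<close>
    sends out at most one such edge.\<close>
  have "2 * card L \<le> card U"
  proof -
    let ?E = "\<Union>x\<in>L. S x"
    have "card ?E = (\<Sum>x\<in>L. card (S x))"
    proof (rule card_UN_disjoint)
      show "\<forall>x\<in>L. \<forall>y\<in>L. x \<noteq> y \<longrightarrow> S x \<inter> S y = {}"
      proof (intro ballI impI)
        fix x y assume x: "x \<in> L" and y: "y \<in> L" and ne: "x \<noteq> y"
        have xy: "x \<in> W" "y \<notin> U" using x y LW by (auto simp: W_def)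
        have "e \<notin> S y" if e: "e \<in> S x" for e
          using adj[OF e xy(1)] xy(2) ne by (auto simp: S_def)
        then show "S x \<inter> S y = {}" by blast
      qed
    qed (use fin finL in auto)
    also have "\<dots> = 2 * card L" by (simp add: L_def W2_def)
    finally have card: "card ?E = 2 * card L" .
    have "\<exists>u. u \<in> U \<and> (\<exists>x\<in>L. ends G e = {u, x})" if "e \<in> ?E" for e
      using adj[of e] that LW by blast
    then obtain t where t: "\<And>e. e \<in> ?E \<Longrightarrow> t e \<in> U \<and> (\<exists>x\<in>L. ends G e = {t e, x})" by metis
    have "inj_on t ?E"
    proof (rule inj_onI)
      fix e f assume e: "e \<in> ?E" and f: "f \<in> ?E" and eq: "t e = t f"
      obtain x where x: "x \<in> L" "ends G e = {t e, x}" using t[OF e] by blast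
      obtain y where y: "y \<in> L" "ends G f = {t e, y}" using t[OF f] eq by auto
      obtain g where g: "g \<in> edges G" "c g = 0" "ends G g = {x, m x}" using m[of x] x LW by blast
      obtain h where h: "h \<in> edges G" "c h = 0" "ends G h = {y, m y}" using m[of y] y LW by blast
      have E: "e \<in> edges G" "f \<in> edges G" using e f by (auto simp: S_def F_def)
      have "t e \<in> verts G" "misses c 0 (t e)" using t[OF e] by (auto simp: U_def)
      moreover have "core c (m x)" "core c (m y)" using x y by (auto simp: L_def X_def)
      ultimately show "e = f"
        using exceptional_edge_unique[OF c _ _ E(1) x(2) g _ E(2) y(2) h] by blast
    qed
    moreover have "t ` ?E \<subseteq> U" using t by blast
    ultimately have "card ?E \<le> card U" using fin by (intro card_inj_on_le[of t]) auto
    then show ?thesis using card by simp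
  qed
  \<comment> \<open>The partners of \<open>W2 - L\<close> avoid the core by the choice of
    \<open>L\<close>, avoid \<open>W\<close> by \<open>mW\<close>, and avoid \<open>U\<close>
    because they lie on an edge of colour 0.\<close>
  moreover have "card X + card U + card W + card (W2 - L) \<le> card (verts G)"
  proof -
    have "card (W2 - L) = card (m ` (W2 - L))"
      using inj by (intro card_image[symmetric]) (auto simp: inj_on_def W2_def)
    moreover have "X \<inter> U = {}" using core_not_misses_0[OF c] by (auto simp: X_def U_def)
    moreover have "X \<inter> W = {}"
    proof -
      have False if x: "x \<in> W" "x \<in> X" for x
      proof -
        obtain e where e: "e \<in> S x" using x by (auto simp: W_def)
        obtain u where "u \<in> U" "ends G e = {u, x}" using adj[OF e x(1)] by blast
        then show False
          using core_not_adjacent[OF c, of x e u] e x by (auto simp: X_def U_def S_def F_def)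
      qed
      then show ?thesis by blast
    qed
    moreover have "U \<inter> W = {}" by (auto simp: W_def)
    moreover have "(X \<union> U \<union> W) \<inter> m ` (W2 - L) = {}"
    proof -
      have "m x \<notin> X \<union> U \<union> W" if "x \<in> W2 - L" for x
        using that mU[of x] mW[of x] by (auto simp: L_def W2_def)
      then show ?thesis by blast
    qed
    ultimately have "card X + card U + card W + card (W2 - L) = card (X \<union> U \<union> W \<union> m ` (W2 - L))"
      using fin by (simp add: card_Un_disjoint Int_Un_distrib2)
    also have "\<dots> \<le> card (verts G)"
      using finite_verts mU(2) by (intro card_mono) (auto simp: X_def U_def W_def W2_def)
    finally show ?thesis .
  qed
  moreover have "card (W2 - L) = card W2 - card L" "card L \<le> card W2"
    using LW fin finL by (auto intro: card_Diff_subset card_mono)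
  ultimately show ?thesis using W3 unfolding U_def X_def by linarith
qed

section \<open>Existence of an extremal colouring\<close>

lemma exists_optimal:
  obtains c where "optimal c"
    "\<And>c'. optimal c' \<Longrightarrow> card (parallel_in_class_0 c') \<le> card (parallel_in_class_0 c)"
proof -
  let ?n = "card (edges G)"
  \<comment> \<open>The factor exceeds every possible number of coloured edges, so a maximum of this
    sum is a lexicographic maximum.\<close>
  let ?f = "\<lambda>c. card (colour_class c 0) * Suc ?n + card (coloured c)"
  have le: "card (colour_class c i) \<le> ?n" "card (coloured c) \<le> ?n" "card (parallel_in_class_0 c) \<le> ?n" for c i
    using finite_edges by (auto simp: colour_class_def coloured_def parallel_in_class_0_def intro!: card_mono)
  have start: "colouring (\<lambda>_. 3)" by (simp add: colouring_def)
  have "?f c \<le> ?n * Suc ?n + ?n" for c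
    using le by (intro add_mono mult_right_mono) auto
  then have "\<forall>c. colouring c \<longrightarrow> ?f c < Suc (?n * Suc ?n + ?n)" by (simp add: less_Suc_eq_le)
  from ex_has_greatest_nat[of colouring "\<lambda>_. 3" ?f, OF start this]
  obtain c where c: "colouring c" and cmax: "\<And>c'. colouring c' \<Longrightarrow> ?f c' \<le> ?f c" by (elim exE conjE) blast
  have "optimal c"
    unfolding optimal_def
  proof (intro conjI allI impI c)
    fix c' assume c': "colouring c'"
    show le0: "card (colour_class c' 0) \<le> card (colour_class c 0)"
    proof (rule ccontr)
      assume "\<not> ?thesis"
      then have "Suc (card (colour_class c 0)) * Suc ?n \<le> card (colour_class c' 0) * Suc ?n"
        by (intro mult_le_mono1) simp
      then show False using cmax[OF c'] le(2)[of c] by simp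
    qed
    assume "card (colour_class c' 0) = card (colour_class c 0)"
    then show "card (coloured c') \<le> card (coloured c)" using cmax[OF c'] by simp
  qed
  moreover have "\<forall>c. optimal c \<longrightarrow> card (parallel_in_class_0 c) < Suc ?n"
    using le by (simp add: less_Suc_eq_le)
  ultimately have "\<exists>c. optimal c \<and> (\<forall>c'. optimal c' \<longrightarrow> card (parallel_in_class_0 c') \<le> card (parallel_in_class_0 c))"
    by (intro ex_has_greatest_nat)
  then show ?thesis using that by blast
qed

end

section \<open>From colour classes to \<open>nu\<close>\<close>

context finite_multigraph
begin

lemma nu_ge:
  assumes "disjoint_matchings G k H"
  shows "(\<Sum>i<k. card (H i)) \<le> nu k G"
  unfolding nu_def using nu_set_finite_nonempty(1)[of k] assms by (intro Max_ge) auto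

text \<open>\<open>s\<close> selects the colours that form the tuple: all three for
  \<open>nu 3\<close>, colour 0 and one other for \<open>nu 2\<close>.\<close>

lemma colour_classes_disjoint_matchings:
  assumes c: "colouring c" and s: "inj_on s {..<k}" "s ` {..<k} \<subseteq> {..<3}"
  shows "disjoint_matchings G k (\<lambda>i. colour_class c (s i))"
proof -
  have "matching G (colour_class c j)" if "j < 3" for j
    using c that unfolding matching_def colouring_def colour_class_def disjoint_family_on_def by auto
  then show ?thesis
    using s unfolding disjoint_matchings_def disjoint_family_on_def
    by (auto simp: colour_class_def inj_on_def image_subset_iff)
qed

end

theorem theorem5:
  fixes G :: "('v, 'e) multigraph"
  assumes "cubic_multigraph G"
  shows "nu 2 G + nu 3 G \<ge> 2 * card (verts G)"
proof -
  interpret cubic_multigraph G by (rule assms)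
  obtain c where c: "optimal c"
    and max: "\<And>c'. optimal c' \<Longrightarrow> card (parallel_in_class_0 c') \<le> card (parallel_in_class_0 c)"
    using exists_optimal by blast
  have col: "colouring c" using c by (rule optimal_colouring)
  define k where "k i = card {x \<in> verts G. misses c i x}" for i
  have vertices: "2 * card (colour_class c i) + k i = card (verts G)" if "i < 3" for i
  proof -
    have "{e \<in> colour_class c i. ends G e \<subseteq> verts G} = colour_class c i"
      using ends_subset by (auto simp: colour_class_def)
    then show ?thesis
      using card_closed_colour_class[OF col that, of "verts G"] ends_subset by (simp add: k_def)
  qed
  define d where "d = card {x \<in> verts G. core c x}"
  obtain m where "k 1 + k 2 = k 0 + 2 * m" "3 * m \<le> d"
    using card_core[OF c] unfolding k_def d_def by blast
  moreover have "7 * k 0 + 2 * d \<le> 2 * card (verts G)"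
    using card_missing_0_and_core[OF c] max unfolding k_def d_def by blast
  \<comment> \<open>The left-hand side is \<open>7 * k 0 + 6 * m\<close>, and
    \<open>6 * m <= 2 * d\<close>.\<close>
  ultimately have "4 * k 0 + 3 * (k 1 + k 2) \<le> 2 * card (verts G)"
    by simp
  \<comment> \<open>Class \<open>i\<close> has half of \<open>card (verts G) - k i\<close> edges, so
    the weighted sum is \<open>5 * card (verts G)\<close> minus half of the left-hand side
    above.\<close>
  then have weighted: "4 * card (verts G) \<le> 4 * card (colour_class c 0) +
      3 * (card (colour_class c 1) + card (colour_class c 2))"
    using vertices[of 0] vertices[of 1] vertices[of 2] by simp
  have nu3: "card (colour_class c 0) + card (colour_class c 1) + card (colour_class c 2) \<le> nu 3 G"
    using nu_ge[OF colour_classes_disjoint_matchings[OF col, of id 3]]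
    by (simp add: eval_nat_numeral)
  have nu2: "card (colour_class c 0) + card (colour_class c j) \<le> nu 2 G" if "j = 1 \<or> j = 2" for j
    using nu_ge[OF colour_classes_disjoint_matchings[OF col, of "\<lambda>i. if i = 0 then 0 else j" 2]] that
    by (auto simp: numeral_2_eq_2 inj_on_def lessThan_Suc)
  have "card (colour_class c 0) + card (colour_class c 1) \<le> nu 2 G"
    "card (colour_class c 0) + card (colour_class c 2) \<le> nu 2 G"
    using nu2 by blast+
  \<comment> \<open>The two bounds for \<open>nu 2 G\<close> and twice the bound for
    \<open>nu 3 G\<close> add up to the weighted sum.\<close>
  with weighted nu3 show ?thesis by simp
qed

end
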